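(* For each $n$ let $0<x_{1,n}<\dots<x_{n,n}<1$ be deterministic design points and let $Y_{1,n},\dots,Y_{n,n}$ satisfy $\Lambda_0(Y_{i,n})=h_0(x_{i,n})+\varepsilon_{i,n}$, where $\Lambda_0$ is strictly increasing and continuous. Assume: (1) for every $n$, $\varepsilon_{1,n},\dots,\varepsilon_{n,n}$ are independent with cdf $F_0$ (the same for all $n$), where $F_0(0)=1$ and $F_0(-\Delta)<1$ for all $\Delta>0$; (2) $h_0$ is continuous on $[0,1]$; (3) $(b_n)$ is a sequence of positive numbers with $b_n\to0$ and $\bar\Delta_n\log(n)/b_n\to0$, where $\bar\Delta_n=\max_{1\le i\le n+1}(x_{i,n}-x_{i-1,n})$ with $x_{0,n}=0$, $x_{n+1,n}=1$. Let $\tilde h_0(x)=\max\{\Lambda_0(Y_{i,n}): 1\le i\le n,\ |x_{i,n}-x|\le b_n\}$ for $x\in[0,1]$. Then $\|\tilde h_0-h_0\|_\infty=\sup_{x\in[0,1]}|\tilde h_0(x)-h_0(x)|=o_P(1)$ as $n\to\infty$.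
   Context: $o_P(1)$ denotes convergence to $0$ in (outer, if needed) probability. If no $i$ satisfies $|x_{i,n}-x|\le b_n$, set $\tilde h_0(x)=0$. *)

theory Defs
  imports "HOL-Probability.Probability"
begin

text \<open>
  Triangular arrays are functions of the row \<open>n\<close> first and the column \<open>i\<close> second.
  A row \<open>x n\<close> of design points carries the boundary values \<open>x n 0 = 0\<close> and
  \<open>x n (n + 1) = 1\<close>; only the columns \<open>1, \<dots>, n\<close> are observation points.
\<close>

definition max_spacing :: "(nat \<Rightarrow> nat \<Rightarrow> real) \<Rightarrow> nat \<Rightarrow> real" where
  "max_spacing x n = Max ((\<lambda>i. x n i - x n (i - 1)) ` {1..n + 1})"

definition window :: "(nat \<Rightarrow> nat \<Rightarrow> real) \<Rightarrow> (nat \<Rightarrow> real) \<Rightarrow> nat \<Rightarrow> real \<Rightarrow> nat set" where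
  "window x b n t = {i \<in> {1..n}. \<bar>x n i - t\<bar> \<le> b n}"

definition local_max_estimator ::
    "(real \<Rightarrow> real) \<Rightarrow> (nat \<Rightarrow> nat \<Rightarrow> 'a \<Rightarrow> real) \<Rightarrow> (nat \<Rightarrow> nat \<Rightarrow> real) \<Rightarrow> (nat \<Rightarrow> real) \<Rightarrow>
      nat \<Rightarrow> 'a \<Rightarrow> real \<Rightarrow> real" where
  "local_max_estimator \<Lambda> Y x b n \<omega> t =
     (if window x b n t = {} then 0
      else Max ((\<lambda>i. \<Lambda> (Y n i \<omega>)) ` window x b n t))"

text \<open>
  Convergence to 0 in outer probability. The \<open>n\<close>-th variable lives on its own probability
  space \<open>M n\<close> and need not be measurable; for measurable variables this is ordinary
  convergence in probability.
\<close>

definition tendsto_zero_in_outer_prob ::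
    "(nat \<Rightarrow> 'a measure) \<Rightarrow> (nat \<Rightarrow> 'a \<Rightarrow> real) \<Rightarrow> bool" where
  "tendsto_zero_in_outer_prob M Z \<longleftrightarrow>
     (\<forall>e>0. (\<lambda>n. outer_measure_of (M n) {\<omega> \<in> space (M n). \<bar>Z n \<omega>\<bar> > e}) \<longlonglongrightarrow> 0)"

end

theory Submission
  imports Defs
begin

text \<open>
  Almost surely all errors are nonpositive, so the local maximum exceeds \<open>h\<^sub>0\<close> by at most its
  modulus of continuity at \<open>b n\<close>. For the lower bound let \<open>m\<close> be the integer part of
  \<open>b n\<close> divided by the maximal spacing: every window then contains a block of \<open>m\<close> consecutive
  indices, and it suffices that each of the at most \<open>n + 1\<close> such blocks has an error above \<open>- d\<close>.
  By independence this fails with probability at most \<open>(n + 1) * F\<^sub>0 (- d) ^ m\<close>, which tends to 0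
  because \<open>m\<close> dominates \<open>ln n\<close>.
\<close>

section \<open>Probability that a whole block of independent errors is small\<close>

text \<open>Used twice below: for singletons at level 0, where \<open>F\<^sub>0 0 = 1\<close> makes
  positive errors a null event, and for blocks of consecutive indices at level
  \<open>- d\<close>.\<close>

lemma (in prob_space) prob_indep_all_le:
  fixes X :: "'i \<Rightarrow> 'a \<Rightarrow> real"
  assumes indep: "indep_vars (\<lambda>_. borel) X I" and J: "J \<subseteq> I" "finite J"
    and cdf: "\<And>i. i \<in> J \<Longrightarrow> cdf (distr M borel (X i)) c = p"
  shows "prob {\<omega> \<in> space M. \<forall>i\<in>J. X i \<omega> \<le> c} = p ^ card J"
\<comment> \<open>\<open>indep_varsD\<close> needs a nonempty index set. The empty block does occur,
  namely when the block length \<open>m n\<close> is 0; both sides are then 1.\<close>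
proof (cases "J = {}")
  case True
  then show ?thesis by (simp add: prob_space)
next
  case False
  have rv: "X i \<in> borel_measurable M" if "i \<in> I" for i
    using indep that by (auto simp: indep_vars_def)
  have "{\<omega> \<in> space M. \<forall>i\<in>J. X i \<omega> \<le> c} = (\<Inter>i\<in>J. X i -` {..c} \<inter> space M)"
    using False by auto
  also have "prob \<dots> = (\<Prod>i\<in>J. prob (X i -` {..c} \<inter> space M))"
    by (rule indep_varsD[OF indep False J(2) J(1)]) auto
  also have "\<dots> = (\<Prod>i\<in>J. p)"
  proof (rule prod.cong)
    fix i assume "i \<in> J"
    then show "prob (X i -` {..c} \<inter> space M) = p"
      using cdf[of i] measure_distr[OF rv[of i], of "{..c}"] J(1) by (auto simp: cdf_def)
  qed simp
  finally show ?thesis by simp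
qed

section \<open>Blocks of consecutive design points near a given point\<close>

lemma le_add_mult_bounded_increments:
  fixes x :: "nat \<Rightarrow> real"
  assumes "\<And>i. i \<in> {k..<k + r} \<Longrightarrow> x (i + 1) - x i \<le> D"
  shows "x (k + r) \<le> x k + real r * D"
  using assms
proof (induction r)
  case (Suc r)
  have "x (k + r) \<le> x k + real r * D"
    by (rule Suc.IH) (use Suc.prems in auto)
  moreover have "x (k + r + 1) - x (k + r) \<le> D"
    by (rule Suc.prems) auto
  ultimately show ?case by (simp add: algebra_simps)
qed simp

text \<open>Move from \<open>t\<close> towards the farther end of the unit interval: for
  \<open>t \<le> 1 / 2\<close> take the \<open>m\<close> points following \<open>t\<close>,
  otherwise the last \<open>m\<close> points up to \<open>t\<close>. Running out of points would
  mean that at most \<open>m\<close> gaps cover a distance of at least 1/2, which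
  \<open>small\<close> excludes.\<close>

lemma consecutive_points_near:
  fixes x :: "nat \<Rightarrow> real"
  assumes x0: "x 0 = 0" and x1: "x (n + 1) = 1"
    and less: "\<And>i. i \<le> n \<Longrightarrow> x i < x (i + 1)"
    and gap: "\<And>i. i \<le> n \<Longrightarrow> x (i + 1) - x i \<le> D"
    and t: "0 \<le> t" "t \<le> 1" and small: "real m * D < 1 / 2"
  obtains j where "j + m \<le> n" "\<And>i. i \<in> {j + 1..j + m} \<Longrightarrow> \<bar>x i - t\<bar> \<le> real m * D"
proof -
  have D: "D \<ge> 0"
    using less[of 0] gap[of 0] by simp
  have scale: "real r * D \<le> real m * D" if "r \<le> m" for r
    using that D by (intro mult_right_mono) auto
  have mono: "x i \<le> x j" if "i \<le> j" "j \<le> n + 1" for i j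
    using that
  proof (induction j rule: dec_induct)
    case (step j)
    then show ?case using less[of j] by simp
  qed simp
  have step: "x j \<le> x i + real (j - i) * D" if "i \<le> j" "j \<le> n + 1" for i j
    using le_add_mult_bounded_increments[of i "j - i" x D] gap that by auto
  \<comment> \<open>The gap from \<open>x k\<close> to \<open>x (k + 1)\<close> contains
    \<open>t\<close>. The boundary values guarantee this at the extremes: \<open>x 0 = 0\<close>
    makes the set nonempty, and \<open>x (n + 1) = 1\<close> covers \<open>k = n\<close>.\<close>
  define k where "k = (GREATEST i. i \<le> n \<and> x i \<le> t)"
  have k: "k \<le> n" "x k \<le> t"
    using GreatestI_nat[of "\<lambda>i. i \<le> n \<and> x i \<le> t" 0 n] x0 t unfolding k_def by auto
  have k_max: "i \<le> k" if "i \<le> n" "x i \<le> t" for i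
    using Greatest_le_nat[of "\<lambda>i. i \<le> n \<and> x i \<le> t" i n] that unfolding k_def by auto
  have above: "t \<le> x (k + 1)"
  proof (cases "k = n")
    case True
    then show ?thesis using x1 t by simp
  next
    case False
    then show ?thesis using k_max[of "k + 1"] k by force
  qed
  show ?thesis
  proof (cases "t \<le> 1 / 2")
    case True
    have "k + m \<le> n"
    proof (rule ccontr)
      assume *: "\<not> k + m \<le> n"
      have "x (n + 1) \<le> x k + real (n + 1 - k) * D"
        using step[of k "n + 1"] k by simp
      also have "\<dots> \<le> t + real m * D"
        using k scale[of "n + 1 - k"] * by linarith
      finally show False using x1 True small by linarith
    qed
    moreover have "\<bar>x i - t\<bar> \<le> real m * D" if "i \<in> {k + 1..k + m}" for i
    proof -
      have "x (k + 1) \<le> x i"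
        using mono[of "k + 1" i] that \<open>k + m \<le> n\<close> by simp
      moreover have "x i \<le> x k + real (i - k) * D"
        using step[of k i] that \<open>k + m \<le> n\<close> by simp
      moreover have "real (i - k) * D \<le> real m * D"
        using that by (intro scale) auto
      ultimately show ?thesis using above k by linarith
    qed
    ultimately show ?thesis using that by blast
  next
    case False
    have "m \<le> k"
    proof (rule ccontr)
      assume *: "\<not> m \<le> k"
      have "t \<le> x 0 + real (k + 1) * D"
        using step[of 0 "k + 1"] k above by simp
      also have "\<dots> \<le> real m * D"
        using x0 scale[of "k + 1"] * by simp
      finally show False using False small by linarith
    qed
    moreover have "\<bar>x i - t\<bar> \<le> real m * D" if "i \<in> {k - m + 1..k - m + m}" for i
    proof -
      have "i \<le> k" using that \<open>m \<le> k\<close> by simp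
      then have "x i \<le> x k"
        using mono[of i k] k by simp
      \<comment> \<open>Counting gaps up to \<open>k + 1\<close>, at or beyond \<open>t\<close>,
        still gives at most \<open>m\<close> of them, since the block starts at
        \<open>k - m + 1\<close>.\<close>
      moreover have "x (k + 1) \<le> x i + real (k + 1 - i) * D"
        using step[of i "k + 1"] \<open>i \<le> k\<close> k by simp
      moreover have "real (k + 1 - i) * D \<le> real m * D"
        using that by (intro scale) auto
      ultimately show ?thesis using above k by linarith
    qed
    ultimately show ?thesis using that[of "k - m"] k by auto
  qed
qed

section \<open>Decay of the union bound\<close>

lemma mult_power_nat_floor_tendsto_zero:
  fixes D b :: "nat \<Rightarrow> real" and p :: real
  assumes p: "0 \<le> p" "p < 1"
    and D: "\<And>n. n \<ge> 1 \<Longrightarrow> D n > 0" and b: "\<And>n. n \<ge> 1 \<Longrightarrow> b n > 0"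
    and lim: "(\<lambda>n. D n * ln (real n) / b n) \<longlonglongrightarrow> 0"
  shows "(\<lambda>n. real n * p ^ nat \<lfloor>b n / D n\<rfloor>) \<longlonglongrightarrow> 0"
proof (rule tendsto_sandwich)
  \<comment> \<open>\<open>p\<close> may be 0; passing to a positive \<open>q\<close> allows powers
    to be written as exponentials.\<close>
  define q where "q = max p (1 / 2)"
  define c where "c = - ln q"
  have q: "0 < q" "q < 1" "p \<le> q" using p by (auto simp: q_def)
  then have c: "c > 0" by (simp add: c_def)
  show "\<forall>\<^sub>F n in sequentially. 0 \<le> real n * p ^ nat \<lfloor>b n / D n\<rfloor>"
    using p by simp
  \<comment> \<open>The threshold \<open>c / 2\<close> makes \<open>c * (b n / D n)\<close> at least
    \<open>2 * ln n\<close>: one logarithm cancels the factor \<open>n\<close>, the other leaves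
    \<open>1 / n\<close>. Rounding down costs at most a factor \<open>exp c\<close>.\<close>
  have "\<forall>\<^sub>F n in sequentially. D n * ln (real n) / b n < c / 2"
    using order_tendstoD(2)[OF lim, of "c / 2"] c by simp
  then show "\<forall>\<^sub>F n in sequentially. real n * p ^ nat \<lfloor>b n / D n\<rfloor> \<le> exp c / real n"
    using eventually_ge_at_top[of 1]
  proof eventually_elim
    case (elim n)
    define m where "m = nat \<lfloor>b n / D n\<rfloor>"
    have pos: "D n > 0" "b n > 0" using D b elim by auto
    have "2 * ln (real n) \<le> c * (b n / D n)"
      using elim pos by (simp add: field_simps)
    moreover have "b n / D n - 1 \<le> real m"
      unfolding m_def by linarith
    then have "c * (b n / D n - 1) \<le> c * real m"
      using c by (intro mult_left_mono) auto
    ultimately have exponent: "ln (real n) - c * real m \<le> c - ln (real n)"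
      by (simp add: algebra_simps)
    have "q = exp (- c)"
      using q by (simp add: c_def)
    then have "q ^ m = exp (- (c * real m))"
      by (simp flip: exp_of_nat_mult add: mult.commute)
    then have "real n * q ^ m = exp (ln (real n) - c * real m)"
      using elim by (simp add: exp_diff exp_minus field_simps)
    also have "\<dots> \<le> exp (c - ln (real n))"
      using exponent by simp
    also have "\<dots> = exp c / real n"
      using elim by (simp add: exp_diff)
    finally have "real n * q ^ m \<le> exp c / real n" .
    moreover have "real n * p ^ m \<le> real n * q ^ m"
      using p q by (intro mult_left_mono power_mono) auto
    ultimately show ?case unfolding m_def by linarith
  qed
  show "(\<lambda>n. exp c / real n) \<longlonglongrightarrow> 0"
    by (rule lim_const_over_n)
qed simp

section \<open>Deterministic bounds for gaps and local maxima\<close>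

lemma spacing_le_max_spacing:
  assumes "i \<le> n"
  shows "x n (i + 1) - x n i \<le> max_spacing x n"
  unfolding max_spacing_def
  \<comment> \<open>\<open>max_spacing\<close> indexes a gap by its right end, hence the witness
    \<open>i + 1\<close>.\<close>
  using assms by (intro Max_ge) (auto intro!: image_eqI[of _ _ "i + 1"])

text \<open>From above, nonpositive errors leave only the oscillation \<open>d\<close> of
  \<open>f\<close>. From below, the single index \<open>j\<close> suffices, with a loss of
  \<open>d\<close> for the oscillation and another \<open>d\<close> for its error.\<close>

lemma Max_perturbed_near:
  fixes f e :: "'i \<Rightarrow> real"
  assumes fin: "finite W"
    and near: "\<And>i. i \<in> W \<Longrightarrow> \<bar>f i - c\<bar> \<le> d"
    and nonpos: "\<And>i. i \<in> W \<Longrightarrow> e i \<le> 0"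
    and large: "j \<in> W" "e j \<ge> - d"
  shows "\<bar>Max ((\<lambda>i. f i + e i) ` W) - c\<bar> \<le> 2 * d"
proof -
  have "f j + e j \<le> Max ((\<lambda>i. f i + e i) ` W)"
    using fin large(1) by (intro Max_ge) auto
  moreover have "c - d \<le> f j" "0 \<le> d"
    using near[OF large(1)] by (auto simp: abs_le_iff)
  moreover have "f i + e i \<le> c + d" if "i \<in> W" for i
    using near[OF that] nonpos[OF that] by linarith
  then have "Max ((\<lambda>i. f i + e i) ` W) \<le> c + d"
    using fin large(1) by (subst Max_le_iff) auto
  ultimately show ?thesis using large(2) by linarith
qed

section \<open>Uniform consistency of the local maximum\<close>

theorem lemma3p3:
  fixes M :: "nat \<Rightarrow> 'a measure"
    and x :: "nat \<Rightarrow> nat \<Rightarrow> real"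
    and Y \<epsilon> :: "nat \<Rightarrow> nat \<Rightarrow> 'a \<Rightarrow> real"
    and \<Lambda>\<^sub>0 h\<^sub>0 F\<^sub>0 :: "real \<Rightarrow> real"
    and b :: "nat \<Rightarrow> real"
  assumes prob: "\<And>n. n \<ge> 1 \<Longrightarrow> prob_space (M n)"
    and design_0: "\<And>n. n \<ge> 1 \<Longrightarrow> x n 0 = 0"
    and design_1: "\<And>n. n \<ge> 1 \<Longrightarrow> x n (n + 1) = 1"
    and design_less: "\<And>n i. n \<ge> 1 \<Longrightarrow> i \<le> n \<Longrightarrow> x n i < x n (i + 1)"
    and Y_rv: "\<And>n i. n \<ge> 1 \<Longrightarrow> i \<in> {1..n} \<Longrightarrow> Y n i \<in> borel_measurable (M n)"
    and model: "\<And>n i \<omega>. n \<ge> 1 \<Longrightarrow> i \<in> {1..n} \<Longrightarrow> \<omega> \<in> space (M n) \<Longrightarrow>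
                  \<Lambda>\<^sub>0 (Y n i \<omega>) = h\<^sub>0 (x n i) + \<epsilon> n i \<omega>"
    and \<Lambda>_mono: "strict_mono \<Lambda>\<^sub>0"
    and \<Lambda>_cont: "continuous_on UNIV \<Lambda>\<^sub>0"
    and indep: "\<And>n. n \<ge> 1 \<Longrightarrow> prob_space.indep_vars (M n) (\<lambda>_. borel) (\<epsilon> n) {1..n}"
    and cdf_F: "\<And>n i. n \<ge> 1 \<Longrightarrow> i \<in> {1..n} \<Longrightarrow> cdf (distr (M n) borel (\<epsilon> n i)) = F\<^sub>0"
    and F_zero: "F\<^sub>0 0 = 1"
    and F_neg: "\<And>\<Delta>. \<Delta> > 0 \<Longrightarrow> F\<^sub>0 (- \<Delta>) < 1"
    and h_cont: "continuous_on {0..1} h\<^sub>0"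
    and b_pos: "\<And>n. n \<ge> 1 \<Longrightarrow> b n > 0"
    and b_lim: "b \<longlonglongrightarrow> 0"
    and spacing_lim: "(\<lambda>n. max_spacing x n * ln (real n) / b n) \<longlonglongrightarrow> 0"
  shows "tendsto_zero_in_outer_prob M
           (\<lambda>n \<omega>. SUP t\<in>{0..1}. \<bar>local_max_estimator \<Lambda>\<^sub>0 Y x b n \<omega> t - h\<^sub>0 t\<bar>)"
  unfolding tendsto_zero_in_outer_prob_def
proof (intro allI impI)
  fix e :: real
  assume e: "e > 0"
  \<comment> \<open>Half of \<open>e\<close> for the oscillation of \<open>h\<^sub>0\<close> in a
    window, half for the error.\<close>
  define d where "d = e / 2"
  have d: "d > 0" using e by (simp add: d_def)
  define D where "D = max_spacing x"
  define m where "m n = nat \<lfloor>b n / D n\<rfloor>" for n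
  define p where "p = F\<^sub>0 (- d)"
  define Z where "Z n \<omega> = (SUP t\<in>{0..1}. \<bar>local_max_estimator \<Lambda>\<^sub>0 Y x b n \<omega> t - h\<^sub>0 t\<bar>)" for n \<omega>
  have p: "0 \<le> p" "p < 1"
    using cdf_F[of 1 1] F_neg[OF d] by (auto simp: p_def cdf_def simp flip: cdf_F[of 1 1])
  have D_pos: "D n > 0" if "n \<ge> 1" for n
    using spacing_le_max_spacing[of 0 n x] design_less[of n 0] that by (simp add: D_def)
  obtain \<delta> where \<delta>: "\<delta> > 0"
    "\<And>s t. s \<in> {0..1} \<Longrightarrow> t \<in> {0..1} \<Longrightarrow> \<bar>s - t\<bar> < \<delta> \<Longrightarrow> \<bar>h\<^sub>0 s - h\<^sub>0 t\<bar> < d"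
    using compact_uniformly_continuous[OF h_cont] d
    unfolding uniformly_continuous_on_def dist_real_def by (metis compact_Icc)
  \<comment> \<open>\<open>\<delta>\<close> controls the oscillation of \<open>h\<^sub>0\<close> in
    a window; 1/2 leaves room for a block, because \<open>m n * D n \<le> b n\<close>.\<close>
  have "\<forall>\<^sub>F n in sequentially. b n < min \<delta> (1 / 2)"
    using order_tendstoD(2)[OF b_lim, of "min \<delta> (1 / 2)"] \<delta>(1) by simp
  then have "\<forall>\<^sub>F n in sequentially.
      outer_measure_of (M n) {\<omega> \<in> space (M n). \<bar>Z n \<omega>\<bar> > e} \<le> ennreal (2 * (real n * p ^ m n))"
    using eventually_ge_at_top[of 1]
  proof eventually_elim
    case (elim n)
    then have n: "n \<ge> 1" by simp
    interpret prob_space "M n" using prob n .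
    have \<epsilon>_rv: "\<epsilon> n i \<in> borel_measurable (M n)" if "i \<in> {1..n}" for i
      using indep[OF n] that by (auto simp: indep_vars_def)
    have "real (m n) \<le> b n / D n"
      using D_pos[OF n] b_pos[OF n] by (simp add: m_def)
    then have mD: "real (m n) * D n \<le> b n"
      using D_pos[OF n] by (simp add: field_simps)
    have x_mono: "x n i \<le> x n j" if "i \<le> j" "j \<le> n + 1" for i j
      using that
    proof (induction j rule: dec_induct)
      case (step j)
      then show ?case using design_less[OF n, of j] by simp
    qed simp
    have x_range: "x n i \<in> {0..1}" if "i \<le> n + 1" for i
      using x_mono[of 0 i] x_mono[of i "n + 1"] design_0[OF n] design_1[OF n] that by simp
    define P where "P i = {\<omega> \<in> space (M n). \<epsilon> n i \<omega> > 0}" for i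
    define B where "B j = {\<omega> \<in> space (M n). \<forall>i\<in>{j + 1..j + m n}. \<epsilon> n i \<omega> \<le> - d}" for j
    \<comment> \<open>The block positions form a finite family that does not depend on
      \<open>t\<close>; this reduces the supremum over a continuum to a finite union bound.\<close>
    define J where "J = {j. j + m n \<le> n}"
    have P_sets: "P i \<in> events" and P_null: "emeasure (M n) (P i) = 0" if "i \<in> {1..n}" for i
    proof -
      show "P i \<in> events"
        unfolding P_def using \<epsilon>_rv[OF that] by measurable
      have "prob {\<omega> \<in> space (M n). \<forall>k\<in>{i}. \<epsilon> n k \<omega> \<le> 0} = 1 ^ card {i}"
        using indep[OF n] that cdf_F[OF n] F_zero by (intro prob_indep_all_le) auto
      then have "prob (space (M n) - P i) = 1"
        by (simp add: P_def set_diff_eq not_less cong: conj_cong)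
      then show "emeasure (M n) (P i) = 0"
        using prob_compl[OF \<open>P i \<in> events\<close>] by (simp add: emeasure_eq_measure)
    qed
    have B_sets: "B j \<in> events" and B_le: "emeasure (M n) (B j) = ennreal (p ^ m n)"
      if "j \<in> J" for j
    proof -
      have sub: "{j + 1..j + m n} \<subseteq> {1..n}" using that by (auto simp: J_def)
      show "B j \<in> events"
        unfolding B_def
      proof (intro sets.sets_Collect_finite_All)
        fix i assume "i \<in> {j + 1..j + m n}"
        then have "i \<in> {1..n}" using sub by blast
        then show "{\<omega> \<in> space (M n). \<epsilon> n i \<omega> \<le> - d} \<in> events"
          using \<epsilon>_rv by measurable
      qed simp
      have "prob (B j) = p ^ card {j + 1..j + m n}"
        unfolding B_def p_def using indep[OF n] sub cdf_F[OF n]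
        by (intro prob_indep_all_le) auto
      then show "emeasure (M n) (B j) = ennreal (p ^ m n)"
        by (simp add: emeasure_eq_measure)
    qed
    have J: "finite J" "card J \<le> n + 1"
    proof -
      have "J \<subseteq> {..n}" by (auto simp: J_def)
      then show "finite J" "card J \<le> n + 1"
        using card_mono[of "{..n}" J] by (auto intro: finite_subset)
    qed
    define E where "E = (\<Union>i\<in>{1..n}. P i) \<union> (\<Union>j\<in>J. B j)"
    have E_sets: "E \<in> events"
      unfolding E_def using P_sets B_sets J(1) by (intro sets.Un sets.finite_UN) auto
    \<comment> \<open>Since \<open>E\<close> is measurable, this inclusion bounds the outer measure
      without any measurability of the supremum.\<close>
    have "{\<omega> \<in> space (M n). \<bar>Z n \<omega>\<bar> > e} \<subseteq> E"
    proof (rule ccontr)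
      assume "\<not> ?thesis"
      then obtain \<omega> where \<omega>: "\<omega> \<in> space (M n)" "\<bar>Z n \<omega>\<bar> > e" "\<omega> \<notin> E"
        by blast
      have nonpos: "\<epsilon> n i \<omega> \<le> 0" if "i \<in> {1..n}" for i
        using \<omega> that by (force simp: E_def P_def)
      have "\<bar>local_max_estimator \<Lambda>\<^sub>0 Y x b n \<omega> t - h\<^sub>0 t\<bar> \<le> e" if t: "t \<in> {0..1}" for t
      proof -
        obtain j where j: "j + m n \<le> n"
          "\<And>i. i \<in> {j + 1..j + m n} \<Longrightarrow> \<bar>x n i - t\<bar> \<le> real (m n) * D n"
        proof (rule consecutive_points_near[of "x n" n "D n" t "m n"])
          show "x n (i + 1) - x n i \<le> D n" if "i \<le> n" for i
            using spacing_le_max_spacing[OF that] by (simp add: D_def)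
          show "real (m n) * D n < 1 / 2" using mD elim by linarith
        qed (use design_0[OF n] design_1[OF n] design_less[OF n] t in auto)
        \<comment> \<open>For \<open>m n = 0\<close> the event \<open>B j\<close> would be the whole
          space, so outside \<open>E\<close> the block is nonempty. Hence so is the window, and the
          default value 0 of the estimator does not arise.\<close>
        from j(1) \<omega> have "\<omega> \<notin> B j" by (auto simp: E_def J_def)
        then obtain i where i: "i \<in> {j + 1..j + m n}" "\<epsilon> n i \<omega> > - d"
          using \<omega> by (auto simp: B_def not_le)
        have i_window: "i \<in> window x b n t"
          using i(1) j mD by (force simp: window_def)
        have "local_max_estimator \<Lambda>\<^sub>0 Y x b n \<omega> t
            = Max ((\<lambda>i. h\<^sub>0 (x n i) + \<epsilon> n i \<omega>) ` window x b n t)"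
        proof -
          have "(\<lambda>i. \<Lambda>\<^sub>0 (Y n i \<omega>)) ` window x b n t
              = (\<lambda>i. h\<^sub>0 (x n i) + \<epsilon> n i \<omega>) ` window x b n t"
            using model[OF n _ \<omega>(1)] by (intro image_cong) (auto simp: window_def)
          then show ?thesis using i_window by (auto simp: local_max_estimator_def)
        qed
        moreover have "\<bar>Max ((\<lambda>i. h\<^sub>0 (x n i) + \<epsilon> n i \<omega>) ` window x b n t) - h\<^sub>0 t\<bar> \<le> 2 * d"
        proof (rule Max_perturbed_near)
          show "finite (window x b n t)" by (simp add: window_def)
          show "\<bar>h\<^sub>0 (x n k) - h\<^sub>0 t\<bar> \<le> d" if "k \<in> window x b n t" for k
          proof -
            have "x n k \<in> {0..1}" "\<bar>x n k - t\<bar> < \<delta>"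
              using that x_range[of k] elim by (auto simp: window_def)
            then show ?thesis using \<delta>(2)[OF _ t] by fastforce
          qed
          show "\<epsilon> n k \<omega> \<le> 0" if "k \<in> window x b n t" for k
            using nonpos that by (auto simp: window_def)
        qed (use i i_window in auto)
        ultimately show ?thesis by (simp add: d_def)
      qed
      then have "\<bar>Z n \<omega>\<bar> \<le> e"
        unfolding Z_def by (intro cSup_abs_le) auto
      with \<omega> show False by simp
    qed
    then have "outer_measure_of (M n) {\<omega> \<in> space (M n). \<bar>Z n \<omega>\<bar> > e} \<le> outer_measure_of (M n) E"
      by (rule outer_measure_of_mono)
    also have "\<dots> = emeasure (M n) E"
      using E_sets by simp
    also have "\<dots> \<le> emeasure (M n) (\<Union>i\<in>{1..n}. P i) + emeasure (M n) (\<Union>j\<in>J. B j)"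
      unfolding E_def using P_sets B_sets J(1)
      by (intro emeasure_subadditive sets.finite_UN) auto
    also have "\<dots> \<le> (\<Sum>i\<in>{1..n}. emeasure (M n) (P i)) + (\<Sum>j\<in>J. emeasure (M n) (B j))"
      using P_sets B_sets J(1) by (intro add_mono emeasure_subadditive_finite) auto
    also have "\<dots> = ennreal (real (card J) * p ^ m n)"
      using P_null B_le p by (simp add: ennreal_mult ennreal_of_nat_eq_real_of_nat)
    also have "\<dots> \<le> ennreal (2 * (real n * p ^ m n))"
    proof (rule ennreal_leI)
      \<comment> \<open>Here \<open>n + 1 \<le> 2 * n\<close>, which brings the bound into the form
        of the decay lemma.\<close>
      have "real (card J) \<le> 2 * real n" using J n by linarith
      then show "real (card J) * p ^ m n \<le> 2 * (real n * p ^ m n)"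
        using p mult_right_mono[of "real (card J)" "2 * real n" "p ^ m n"]
        by (simp add: mult.assoc)
    qed
    finally show ?case .
  qed
  moreover have "(\<lambda>n. ennreal (2 * (real n * p ^ m n))) \<longlonglongrightarrow> 0"
  proof -
    have "(\<lambda>n. real n * p ^ m n) \<longlonglongrightarrow> 0"
      unfolding m_def
      by (rule mult_power_nat_floor_tendsto_zero)
        (use p D_pos b_pos spacing_lim in \<open>auto simp: D_def\<close>)
    then have "(\<lambda>n. 2 * (real n * p ^ m n)) \<longlonglongrightarrow> 0"
      by (rule tendsto_mult_right_zero)
    then show ?thesis using tendsto_ennrealI by fastforce
  qed
  ultimately have "(\<lambda>n. outer_measure_of (M n) {\<omega> \<in> space (M n). \<bar>Z n \<omega>\<bar> > e}) \<longlonglongrightarrow> 0"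
    by (rule tendsto_sandwich[OF always_eventually, OF allI, OF zero_le _ tendsto_const])
  then show "(\<lambda>n. outer_measure_of (M n) {\<omega> \<in> space (M n).
      \<bar>SUP t\<in>{0..1}. \<bar>local_max_estimator \<Lambda>\<^sub>0 Y x b n \<omega> t - h\<^sub>0 t\<bar>\<bar> > e}) \<longlonglongrightarrow> 0"
    by (simp only: Z_def)
qed

end
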